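(* For every real $\rho>3$ there exist constants $c_1,c_2>0$ such that for all integers $r\geq 2$ and $m\geq\max\{\ln^{\rho} r,2\}$, \[c_1 r\ln m\leq\vec\chi_{\ell}(K_{m*r})\leq c_2 r\ln m.\]
   Context: $K_{m*r}$ denotes the complete $r$-partite graph with $m$ vertices in each part. A $k$-list assignment to a digraph $D$ is a map $L$ assigning to each vertex $v$ a set $L(v)$ of $k$ positive integers; a colouring $f$ is accepted by $L$ if $f(v)\in L(v)$ for all $v$. A colouring is proper if every colour class induces a subdigraph with no directed cycle. The list dichromatic number $\vec\chi_\ell(D)$ is the least $k$ such that every $k$-list assignment accepts a proper colouring; for an undirected graph $G$, $\vec\chi_\ell(G)$ is the maximum of $\vec\chi_\ell(D)$ over all orientations $D$ of $G$. *)

theory Defs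
  imports Complex_Main "Graph_Theory.Digraph_Component"
begin

text \<open>
  Following \<^theory>\<open>Graph_Theory.Digraph\<close>, an undirected graph is a symmetric digraph: the edge
  between \<open>u\<close> and \<open>v\<close> is the pair of arcs \<open>(u, v)\<close> and \<open>(v, u)\<close>.
\<close>

definition complete_multipartite :: "nat \<Rightarrow> nat \<Rightarrow> (nat \<times> nat) pair_pre_digraph" where
  "complete_multipartite m r =
     \<lparr> pverts = {..<r} \<times> {..<m},
       parcs = {(u, v). u \<in> {..<r} \<times> {..<m} \<and> v \<in> {..<r} \<times> {..<m} \<and> fst u \<noteq> fst v} \<rparr>"

definition orientation_of :: "'a pair_pre_digraph \<Rightarrow> 'a pair_pre_digraph \<Rightarrow> bool" where
  "orientation_of D G \<longleftrightarrow>
     pverts D = pverts G \<and> parcs D \<subseteq> parcs G \<and>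
     (\<forall>(u, v) \<in> parcs G. (u, v) \<in> parcs D \<longleftrightarrow> (v, u) \<notin> parcs D)"

definition acyclic_digraph :: "('a, 'b) pre_digraph \<Rightarrow> bool" where
  "acyclic_digraph D \<longleftrightarrow> (\<nexists>p. pre_digraph.cycle D p)"

definition proper_colouring :: "'a pair_pre_digraph \<Rightarrow> ('a \<Rightarrow> nat) \<Rightarrow> bool" where
  "proper_colouring D f \<longleftrightarrow>
     (\<forall>c. acyclic_digraph (with_proj D \<restriction> {v \<in> pverts D. f v = c}))"

text \<open>Finiteness is stated separately because an infinite set has cardinality \<open>0\<close> in HOL.\<close>

definition list_assignment :: "nat \<Rightarrow> 'a pair_pre_digraph \<Rightarrow> ('a \<Rightarrow> nat set) \<Rightarrow> bool" where
  "list_assignment k D L \<longleftrightarrow>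
     (\<forall>v \<in> pverts D. L v \<subseteq> {1..} \<and> finite (L v) \<and> card (L v) = k)"

definition accepted :: "'a pair_pre_digraph \<Rightarrow> ('a \<Rightarrow> nat set) \<Rightarrow> ('a \<Rightarrow> nat) \<Rightarrow> bool" where
  "accepted D L f \<longleftrightarrow> (\<forall>v \<in> pverts D. f v \<in> L v)"

definition list_dichromatic_number :: "'a pair_pre_digraph \<Rightarrow> nat" where
  "list_dichromatic_number D =
     (LEAST k. \<forall>L. list_assignment k D L \<longrightarrow> (\<exists>f. accepted D L f \<and> proper_colouring D f))"

definition graph_list_dichromatic_number :: "'a pair_pre_digraph \<Rightarrow> nat" where
  "graph_list_dichromatic_number G =
     Max {list_dichromatic_number D | D. orientation_of D G}"

end

theory Submission
  imports Defs "HOL-Real_Asymp.Real_Asymp"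
begin

text \<open>
  Upper bound: it suffices to distribute the colours over the parts so that every vertex keeps a
  colour of its list that is given to its own part. A random distribution succeeds directly only if
  \<open>m\<close> is at least a power of \<open>r\<close>, so this is done in two rounds: the colours are first distributed
  over groups of about \<open>ln r\<close> parts, where a Chernoff bound keeps a proportional share of every list,
  and then inside each group, where \<open>m\<close> is at least the number of parts.

  Lower bound: in a random orientation every acyclic set has all but \<open>O(ln (m r))\<close> of its vertices in
  a single part, because a topological ordering of the set prescribes the direction of every edge
  inside it. A proper colouring therefore assigns to each colour a part such that at most \<open>O(ln (m r))\<close>
  vertices of that colour lie elsewhere. For \<open>k = c r ln m\<close> and lists that are random \<open>k\<close>-subsets of
  \<open>8 k\<close> colours, every assignment \<open>\<phi>\<close> of colours to parts leaves about \<open>r m\<^bsup>1 - O(c)\<^esup>\<close> vertices whose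
  list contains no colour of their own part, which is more than these exceptions can absorb.
\<close>

section \<open>Averaging\<close>

text \<open>
  All probabilistic arguments are phrased as weighted counts: the event that a count \<open>X\<close> is at most
  \<open>t\<close> is dominated by the weight \<open>2\<^bsup>t - X\<^esup>\<close>, which is a product and can be summed over a function space.
\<close>

lemma exists_weight_less_one:
  fixes w :: "'a \<Rightarrow> real"
  assumes "(\<Sum>x\<in>S. w x) < real (card S)"
  shows "\<exists>x\<in>S. w x < 1"
proof (rule ccontr)
  assume "\<not> ?thesis"
  hence "(\<Sum>x\<in>S. 1) \<le> (\<Sum>x\<in>S. w x)" by (intro sum_mono) auto
  with assms show False by simp
qed

lemma prod_half_if:
  assumes "finite S"
  shows "(\<Prod>x\<in>S. if P x then 1/2 else 1 :: real) = (1/2) ^ card {x\<in>S. P x}"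
proof -
  have "(\<Prod>x\<in>S. if P x then 1/2 else 1 :: real) = (\<Prod>x\<in>{x\<in>S. P x}. 1/2)"
    using assms by (simp add: prod.If_cases Collect_conj_eq)
  thus ?thesis by simp
qed

lemma one_le_two_power_mult_half_power:
  assumes "x \<le> t"
  shows "1 \<le> (2::real) ^ t * (1/2) ^ x"
proof -
  have "(2::real) ^ t * (1/2) ^ x = 2 ^ (t - x)"
    using assms by (simp add: power_diff power_divide)
  thus ?thesis by simp
qed

section \<open>Distributing colours over groups\<close>

text \<open>For a uniformly random \<open>\<psi>\<close> a colour goes to a given group with
  probability 1/g. If X counts the colours of \<open>L v\<close> given to the group of
  \<open>v\<close>, then 2^(-X) has mean (1 - 1/(2g))^|L v|, which is at most exp(-k/(2g)).
  Hypothesis \<open>small\<close> closes the union bound over \<open>V\<close>.\<close>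

lemma exists_colour_distribution:
  fixes L :: "'v \<Rightarrow> 'c set" and \<gamma> :: "'v \<Rightarrow> nat"
  assumes fin: "finite V" "\<And>v. v \<in> V \<Longrightarrow> finite (L v)"
    and size: "\<And>v. v \<in> V \<Longrightarrow> k \<le> card (L v)"
    and \<gamma>: "\<And>v. v \<in> V \<Longrightarrow> \<gamma> v < g"
    and small: "real (card V) * 2 ^ t < exp (real k / (2 * real g))"
  shows "\<exists>\<psi>. \<forall>v\<in>V. t \<le> card {c \<in> L v. \<psi> c = \<gamma> v}"
proof (cases "V = {}")
  case False
  then have g: "g > 0" using \<gamma> by fastforce
  define S where "S = (\<Union>v\<in>V. L v)"
  have finS: "finite S" using fin by (auto simp: S_def)
  define \<Psi> where "\<Psi> = PiE S (\<lambda>_. {..<g})"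
  \<comment> \<open>The weight 2^(-X), written as a product over all of \<open>S\<close> so that its
    sum over \<open>\<Psi>\<close> factors colour by colour.\<close>
  define hit where "hit \<psi> v = (\<Prod>c\<in>S. if c \<in> L v \<and> \<psi> c = \<gamma> v then 1/2 else 1 :: real)"
    for \<psi> v
  have hit: "hit \<psi> v = (1/2) ^ card {c \<in> L v. \<psi> c = \<gamma> v}" if "v \<in> V" for \<psi> v
  proof -
    have "{c \<in> S. c \<in> L v \<and> \<psi> c = \<gamma> v} = {c \<in> L v. \<psi> c = \<gamma> v}"
      using that by (auto simp: S_def)
    thus ?thesis unfolding hit_def by (subst prod_half_if[OF finS]) simp
  qed
  have card\<Psi>: "real (card \<Psi>) = real g ^ card S"
    by (simp add: \<Psi>_def card_PiE finS)
  have moment: "(\<Sum>\<psi>\<in>\<Psi>. hit \<psi> v) \<le> real (card \<Psi>) * exp (- (real k / (2 * real g)))"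
    if v: "v \<in> V" for v
  proof -
    have sub: "L v \<subseteq> S" using v by (auto simp: S_def)
    have "(\<Sum>\<psi>\<in>\<Psi>. hit \<psi> v) = (\<Prod>c\<in>S. \<Sum>j<g. if c \<in> L v \<and> j = \<gamma> v then 1/2 else 1)"
      unfolding hit_def \<Psi>_def by (subst prod_sum_PiE) (auto simp: finS)
    also have "\<dots> = (\<Prod>c\<in>S. real g * (if c \<in> L v then 1 - 1 / (2 * real g) else 1))"
    proof (rule prod.cong)
      fix c
      show "(\<Sum>j<g. if c \<in> L v \<and> j = \<gamma> v then 1/2 else 1)
          = real g * (if c \<in> L v then 1 - 1 / (2 * real g) else 1)"
      proof (cases "c \<in> L v")
        case True
        have "(\<Sum>j<g. if j = \<gamma> v then 1/2 else 1 :: real) = (\<Sum>j<g. 1 - (if j = \<gamma> v then 1/2 else 0))"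
          by (intro sum.cong) auto
        also have "\<dots> = real g - 1/2" using \<gamma>[OF v] by (simp add: sum_subtractf)
        also have "\<dots> = real g * (1 - 1 / (2 * real g))" using g by (simp add: field_simps)
        finally show ?thesis using True by simp
      qed auto
    qed simp
    also have "\<dots> = real (card \<Psi>) * (\<Prod>c\<in>S. if c \<in> L v then 1 - 1 / (2 * real g) else 1)"
      by (simp add: prod.distrib card\<Psi>)
    also have "(\<Prod>c\<in>S. if c \<in> L v then 1 - 1 / (2 * real g) else 1) = (1 - 1 / (2 * real g)) ^ card (L v)"
      using sub by (simp add: prod.If_cases[OF finS] Int_absorb1)
    also have "\<dots> \<le> (1 - 1 / (2 * real g)) ^ k"
      using g size[OF v] by (intro power_decreasing) (auto simp: field_simps)
    also have "\<dots> \<le> exp (- 1 / (2 * real g)) ^ k"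
      using g exp_ge_add_one_self[of "- 1 / (2 * real g)"]
      by (intro power_mono) (auto simp: field_simps)
    also have "\<dots> = exp (- (real k / (2 * real g)))"
      by (simp add: exp_of_nat_mult[symmetric])
    finally show ?thesis by (simp add: mult_left_mono)
  qed
  have "(\<Sum>\<psi>\<in>\<Psi>. \<Sum>v\<in>V. 2 ^ t * hit \<psi> v) = (\<Sum>v\<in>V. 2 ^ t * (\<Sum>\<psi>\<in>\<Psi>. hit \<psi> v))"
    by (subst sum.swap) (simp add: sum_distrib_left)
  also have "\<dots> \<le> (\<Sum>v\<in>V. 2 ^ t * (real (card \<Psi>) * exp (- (real k / (2 * real g)))))"
    by (intro sum_mono mult_left_mono moment) auto
  also have "\<dots> = real (card \<Psi>) * (real (card V) * 2 ^ t * exp (- (real k / (2 * real g))))"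
    by simp
  also have "\<dots> < real (card \<Psi>) * 1"
    using small g by (intro mult_strict_left_mono) (auto simp: exp_minus field_simps card\<Psi>)
  finally obtain \<psi> where \<psi>: "(\<Sum>v\<in>V. 2 ^ t * hit \<psi> v) < 1"
    using exists_weight_less_one[of "\<lambda>\<psi>. \<Sum>v\<in>V. 2 ^ t * hit \<psi> v" \<Psi>] by auto
  have "t \<le> card {c \<in> L v. \<psi> c = \<gamma> v}" if v: "v \<in> V" for v
  proof (rule ccontr)
    assume "\<not> ?thesis"
    hence "1 \<le> 2 ^ t * hit \<psi> v"
      unfolding hit[OF v] by (intro one_le_two_power_mult_half_power) simp
    also have "\<dots> \<le> (\<Sum>v\<in>V. 2 ^ t * hit \<psi> v)"
      using v fin(1) by (intro member_le_sum) (auto simp: hit)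
    finally show False using \<psi> by simp
  qed
  thus ?thesis by blast
qed auto

section \<open>Distribution of the colours over the parts in two rounds\<close>

lemma half_le_ln:
  assumes "(x::real) \<ge> 2"
  shows "1/2 \<le> ln x"
proof -
  have "ln (1 / 2 :: real) \<le> 1 / 2 - 1" by (rule ln_le_minus_one) simp
  hence "1 / 2 \<le> ln (2 :: real)" by (simp add: ln_div)
  also have "\<dots> \<le> ln x" using assms by simp
  finally show ?thesis .
qed

text \<open>Part i is encoded by its group \<open>i div s\<close> and its position
  \<open>i mod s\<close> in that group. The first round leaves every vertex at least
  \<open>t\<close> colours of its group, the second at least one colour of its position. Such a
  colour determines group and position, hence the part.\<close>

lemma exists_part_separating_colouring:
  fixes r m k :: nat and L :: "nat \<times> nat \<Rightarrow> nat set"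
  assumes r: "r \<ge> 2" and m: "m \<ge> 2" "ln (real r) \<le> real m"
    and L: "\<And>v. v \<in> {..<r} \<times> {..<m} \<Longrightarrow> finite (L v) \<and> card (L v) = k"
    and k: "real k > 52 * real r * ln (real m)"
  shows "\<exists>f. \<forall>u\<in>{..<r} \<times> {..<m}. f u \<in> L u \<and>
    (\<forall>v\<in>{..<r} \<times> {..<m}. f u = f v \<longrightarrow> fst u = fst v)"
proof -
  define V where "V = {..<r} \<times> {..<m}"
  \<comment> \<open>With s \<ge> ln r the first union bound absorbs the factor r in the number of
    vertices, and s \<le> ln r + 1 \<le> 2m keeps the groups small enough for the second. The 8 in
    \<open>t\<close> gives t/(2s) > 4 ln m, so a vertex fails in the second round with weight below
    m^(-4).\<close>
  define s where "s = nat \<lceil>ln (real r)\<rceil>"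
  define g where "g = r div s + 1"
  define t where "t = nat \<lfloor>8 * real s * ln (real m)\<rfloor> + 1"
  have lnr: "ln (real r) > 0" using r by simp
  have lnm: "ln (real m) \<ge> 1/2" using m by (intro half_le_ln) simp
  have s1: "s \<ge> 1" unfolding s_def using lnr by linarith
  have s_lower: "ln (real r) \<le> real s" unfolding s_def by linarith
  have s_upper: "real s \<le> ln (real r) + 1" unfolding s_def using lnr by linarith
  have s_ln: "real s \<le> 2 * real s * ln (real m)" 
    using mult_left_mono[OF lnm, of "2 * real s"] by simp
  have V_fin: "finite V" by (simp add: V_def)
  have slnm: "8 * real s * ln (real m) \<ge> 0" using lnm by simp
  have t_lower: "real t > 8 * real s * ln (real m)" unfolding t_def using slnm by linarith
  have t_upper: "real t \<le> 10 * real s * ln (real m)"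
  proof -
    have "real t \<le> 8 * real s * ln (real m) + 1" unfolding t_def using slnm by linarith
    also have "1 \<le> 2 * real s * ln (real m)" using s_ln s1 by linarith
    finally show ?thesis by simp
  qed
  have gs: "real g * real s \<le> 2 * real r"
  proof -
    have "g * s \<le> r + s" by (simp add: g_def)
    hence "real g * real s \<le> real r + real s" by (metis of_nat_add of_nat_le_iff of_nat_mult)
    moreover have "ln (real r) \<le> real r - 1" using r by (intro ln_le_minus_one) simp
    ultimately show ?thesis using s_upper by linarith
  qed
  have g_pos: "real g > 0" by (simp add: g_def)
  have "\<exists>\<psi>. \<forall>v\<in>V. t \<le> card {c \<in> L v. \<psi> c = fst v div s}"
  proof (rule exists_colour_distribution)
    show "fst v div s < g" if "v \<in> V" for v
      using that s1 by (auto simp: V_def g_def le_imp_less_Suc div_le_mono)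
    have "real (card V) * 2 ^ t = exp (ln (real r) + ln (real m) + real t * ln 2)"
      using r m by (simp add: V_def exp_add exp_of_nat_mult)
    also have "\<dots> < exp (real k / (2 * real g))"
    proof (subst exp_less_cancel_iff)
      have "ln (real r) + ln (real m) + real t * ln 2 \<le> real s + real s * ln (real m) + real t * 1"
        using s_lower s1 lnm ln_2_less_1
        by (intro add_mono mult_left_mono) (auto simp: mult_le_cancel_right1)
      \<comment> \<open>Here 13 = 2 + 1 + 10, by s \<le> 2 s ln m and the upper bound on
        \<open>t\<close>. Multiplying by 2g and using gs \<le> 2r turns it into the 52 of the
        hypothesis on \<open>k\<close>.\<close>
      also have "\<dots> \<le> 13 * real s * ln (real m)" using s_ln t_upper by simp
      also have "\<dots> < real k / (2 * real g)"
      proof -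
        have "13 * real s * ln (real m) * (2 * real g) = 26 * ln (real m) * (real g * real s)" by simp
        also have "\<dots> \<le> 26 * ln (real m) * (2 * real r)" using gs lnm by (intro mult_left_mono) auto
        also have "\<dots> < real k" using k by (simp add: mult_ac)
        finally show ?thesis using g_pos by (simp add: field_simps)
      qed
      finally show "ln (real r) + ln (real m) + real t * ln 2 < real k / (2 * real g)" .
    qed
    finally show "real (card V) * 2 ^ t < exp (real k / (2 * real g))" .
  qed (use L V_fin in \<open>auto simp: V_def\<close>)
  then obtain \<psi> where \<psi>: "\<And>v. v \<in> V \<Longrightarrow> t \<le> card {c \<in> L v. \<psi> c = fst v div s}" by blast
  \<comment> \<open>Different groups use disjoint sets of colours, so the second round runs
    separately for each \<open>a\<close>, with its own \<open>\<phi>\<close>.\<close>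
  have "\<exists>\<phi>. \<forall>v\<in>{v\<in>V. fst v div s = a}. 1 \<le> card {c \<in> {c \<in> L v. \<psi> c = fst v div s}. \<phi> c = fst v mod s}"
    for a
  proof (rule exists_colour_distribution)
    have "{v\<in>V. fst v div s = a} \<subseteq> {a * s..<a * s + s} \<times> {..<m}"
    proof
      fix v assume v: "v \<in> {v\<in>V. fst v div s = a}"
      have "fst v mod s < s" using s1 by simp
      moreover have "fst v = a * s + fst v mod s" using v by auto
      ultimately have "fst v \<in> {a * s..<a * s + s}" unfolding atLeastLessThan_iff by linarith
      thus "v \<in> {a * s..<a * s + s} \<times> {..<m}" using v by (auto simp: V_def mem_Times_iff)
    qed
    hence "card {v\<in>V. fst v div s = a} \<le> s * m"
      using card_mono[of "{a * s..<a * s + s} \<times> {..<m}"] by (simp add: card_cartesian_product)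
    hence "real (card {v\<in>V. fst v div s = a}) \<le> real s * real m"
      unfolding of_nat_mult[symmetric] of_nat_le_iff .
    hence "real (card {v\<in>V. fst v div s = a}) * 2 ^ 1 \<le> real s * real m * 2"
      by simp
    also have "real s \<le> 2 * real m" using s_upper m by linarith
    hence "real s * real m * 2 \<le> 2 * real m * real m * 2" by (intro mult_right_mono) auto
    also have "\<dots> \<le> real m ^ 4"
    proof -
      have "real 2 * real 2 \<le> real m * real m" using m by (intro mult_mono) auto
      hence "4 * (real m * real m) \<le> (real m * real m) * (real m * real m)"
        by (intro mult_right_mono) auto
      thus ?thesis by (simp add: power4_eq_xxxx mult_ac)
    qed
    also have "\<dots> = exp (4 * ln (real m))" using m exp_of_nat_mult[of 4 "ln (real m)"] by simp
    also have "\<dots> < exp (real t / (2 * real s))"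
      using t_lower s1 by (subst exp_less_cancel_iff) (simp add: field_simps)
    finally show "real (card {v\<in>V. fst v div s = a}) * 2 ^ 1 < exp (real t / (2 * real s))" .
    show "finite {v\<in>V. fst v div s = a}" using V_fin by simp
    show "finite {c \<in> L v. \<psi> c = fst v div s}" if "v \<in> {v\<in>V. fst v div s = a}" for v
      using L[of v] that by (simp add: V_def)
    show "t \<le> card {c \<in> L v. \<psi> c = fst v div s}" if "v \<in> {v\<in>V. fst v div s = a}" for v
      using \<psi>[of v] that by simp
    show "fst v mod s < s" for v :: "nat \<times> nat" using s1 by simp
  qed
  hence "\<exists>\<phi>. \<forall>a. \<forall>v\<in>{v\<in>V. fst v div s = a}.
      1 \<le> card {c \<in> {c \<in> L v. \<psi> c = fst v div s}. \<phi> a c = fst v mod s}"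
    by (intro choice allI)
  then obtain \<phi> where \<phi>_all: "\<forall>a. \<forall>v\<in>{v\<in>V. fst v div s = a}.
      1 \<le> card {c \<in> {c \<in> L v. \<psi> c = fst v div s}. \<phi> a c = fst v mod s}" ..
  have \<phi>: "1 \<le> card {c \<in> {c \<in> L v. \<psi> c = fst v div s}. \<phi> (fst v div s) c = fst v mod s}"
    if "v \<in> V" for v
    using \<phi>_all[rule_format, of v "fst v div s"] that by simp
  have "\<exists>c. c \<in> L v \<and> \<psi> c = fst v div s \<and> \<phi> (fst v div s) c = fst v mod s" if "v \<in> V" for v
  proof (rule ccontr)
    assume "\<not> ?thesis"
    hence empty: "{c \<in> {c \<in> L v. \<psi> c = fst v div s}. \<phi> (fst v div s) c = fst v mod s} = {}"
      by blast
    show False using \<phi>[OF that] unfolding empty by simp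
  qed
  then obtain f where f: "\<And>v. v \<in> V \<Longrightarrow>
      f v \<in> L v \<and> \<psi> (f v) = fst v div s \<and> \<phi> (fst v div s) (f v) = fst v mod s"
    by metis
  have "fst u = fst v" if "u \<in> V" "v \<in> V" "f u = f v" for u v
    using f[OF that(1)] f[OF that(2)] that(3) by (metis div_mult_mod_eq)
  with f show ?thesis unfolding V_def by blast
qed

section \<open>Orientations in which acyclic sets are almost contained in one part\<close>

text \<open>An element without predecessors in \<open>A\<close> goes first, and the rest is ordered
  by induction; no arc then runs backwards along the list.\<close>

lemma exists_topological_list:
  assumes "finite A" "acyclic (R \<inter> A \<times> A)"
  shows "\<exists>xs. distinct xs \<and> set xs = A \<and> sorted_wrt (\<lambda>x y. (y, x) \<notin> R) xs"
  using assms
proof (induction A rule: finite_psubset_induct)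
  case (psubset A)
  show ?case
  proof (cases "A = {}")
    case False
    have "wf (R \<inter> A \<times> A)" using psubset by (intro finite_acyclic_wf) auto
    then obtain x where x: "x \<in> A" "\<And>y. (y, x) \<in> R \<inter> A \<times> A \<Longrightarrow> y \<notin> A"
      using False by (metis ex_in_conv wfE_min)
    have "acyclic (R \<inter> (A - {x}) \<times> (A - {x}))"
      using psubset.prems by (rule acyclic_subset) auto
    moreover have "A - {x} \<subset> A" using x(1) by blast
    ultimately obtain xs where xs: "distinct xs" "set xs = A - {x}" "sorted_wrt (\<lambda>x y. (y, x) \<notin> R) xs"
      using psubset.IH[of "A - {x}"] by blast
    moreover have "(y, x) \<notin> R" if "y \<in> A" for y using x that by blast
    ultimately have "distinct (x # xs) \<and> set (x # xs) = A \<and> sorted_wrt (\<lambda>x y. (y, x) \<notin> R) (x # xs)"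
      using x(1) by (simp add: insert_absorb)
    thus ?thesis by blast
  qed auto
qed

text \<open>A random subset of \<open>E\<close> has a prescribed trace on \<open>F\<close> with
  probability 2^(-|F|), since its part outside \<open>F\<close> is free.\<close>

lemma card_subsets_with_trace:
  assumes "finite E" "F \<subseteq> E" "G \<subseteq> F"
  shows "real (card {\<omega> \<in> Pow E. \<omega> \<inter> F = G}) = 2 ^ card E * (1/2) ^ card F"
proof -
  have "{\<omega> \<in> Pow E. \<omega> \<inter> F = G} = (\<lambda>Z. Z \<union> G) ` Pow (E - F)"
  proof (intro subset_antisym subsetI)
    fix \<omega> assume \<omega>: "\<omega> \<in> {\<omega> \<in> Pow E. \<omega> \<inter> F = G}"
    then have "\<omega> = (\<omega> - F) \<union> G" "\<omega> - F \<in> Pow (E - F)" by auto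
    thus "\<omega> \<in> (\<lambda>Z. Z \<union> G) ` Pow (E - F)" by blast
  qed (use assms in auto)
  moreover have "inj_on (\<lambda>Z. Z \<union> G) (Pow (E - F))"
    using assms by (auto simp: inj_on_def)
  ultimately have "card {\<omega> \<in> Pow E. \<omega> \<inter> F = G} = 2 ^ card (E - F)"
    using assms by (simp add: card_image card_Pow)
  also have "card (E - F) = card E - card F"
    using assms by (intro card_Diff_subset) (auto intro: finite_subset)
  finally have "real (card {\<omega> \<in> Pow E. \<omega> \<inter> F = G}) = 2 ^ (card E - card F)" by simp
  also have "\<dots> = 2 ^ card E * (1/2) ^ card F"
    using assms by (simp add: power_diff card_mono power_divide)
  finally show ?thesis .
qed

text \<open>The union bound runs over orderings instead of sets. If l vertices include at least 2q
  outside each part, they span at least l q edges, so a given ordering of them is topological with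
  probability at most 2^(-l q). With n = r m there are at most n^l orderings of length l, and n
  2^(-q) \<le> 1/2 bounds the total by a geometric sum below 1.\<close>

lemma exists_orientation_acyclic_near_part:
  assumes m: "m > 0" and r: "r > 0" and q: "2 * (r * m) \<le> 2 ^ q"
  shows "\<exists>D. orientation_of D (complete_multipartite m r) \<and>
    (\<forall>A \<subseteq> {..<r} \<times> {..<m}. acyclic (parcs D \<inter> A \<times> A) \<longrightarrow>
      (\<exists>i<r. card {v\<in>A. fst v \<noteq> i} < 2 * q))"
proof -
  define V where "V = {..<r} \<times> {..<m}"
  define n where "n = r * m"
  have V: "finite V" "card V = n" by (auto simp: V_def n_def)
  define E where "E = {(u, v). u \<in> V \<and> v \<in> V \<and> fst u < fst v}"
  have "E \<subseteq> V \<times> V" by (auto simp: E_def)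
  hence finE: "finite E" using V by (auto intro: finite_subset)
  \<comment> \<open>The orderings of the sets to be avoided. Excluding the empty list removes the
    term l = 0, which alone would contribute 1 to the geometric sum.\<close>
  define X where "X = {xs. distinct xs \<and> set xs \<subseteq> V \<and> xs \<noteq> [] \<and>
    (\<forall>i<r. 2 * q \<le> card {v\<in>set xs. fst v \<noteq> i})}"
  \<comment> \<open>An orientation is encoded as the set \<open>\<omega> \<subseteq> E\<close> of edges directed towards the larger part index.
    It has \<open>xs\<close> as a topological ordering iff its trace on \<open>F xs\<close> is \<open>G xs\<close>.\<close>
  define F where "F xs = E \<inter> set xs \<times> set xs" for xs
  define G where "G xs = {(u, v) \<in> F xs. \<exists>i j. i < j \<and> j < length xs \<and> xs ! i = u \<and> xs ! j = v}" for xs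
  have len_le: "length xs \<le> n" if "xs \<in> X" for xs
  proof -
    have "length xs = card (set xs)" using that by (simp add: X_def distinct_card)
    also have "\<dots> \<le> card V" using that V by (intro card_mono) (auto simp: X_def)
    finally show ?thesis using V by simp
  qed
  have X_sub: "X \<subseteq> (\<Union>l\<in>{1..n}. {xs. set xs \<subseteq> V \<and> length xs = l})"
    using len_le by (auto simp: X_def Suc_le_eq)
  have finX: "finite X"
    using X_sub by (rule finite_subset) (use V in \<open>auto intro: finite_lists_length_eq\<close>)
  have cardF: "length xs * q \<le> card (F xs)" if xs: "xs \<in> X" for xs
  proof -
    define A where "A = set xs"
    have A: "A \<subseteq> V" "finite A" "card A = length xs"
      using xs by (auto simp: X_def A_def distinct_card)
    have F: "finite (F xs)" using finE by (simp add: F_def)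
    \<comment> \<open>Double counting: each vertex of \<open>A\<close> has at least 2q neighbours in
      \<open>A\<close>, and the ordered pairs count every edge of \<open>F xs\<close> twice.\<close>
    have "length xs * (2 * q) = (\<Sum>u\<in>A. 2 * q)" using A by simp
    also have "\<dots> \<le> (\<Sum>u\<in>A. card {v\<in>A. fst v \<noteq> fst u})"
    proof (rule sum_mono)
      fix u assume "u \<in> A"
      then have "fst u < r" using A by (auto simp: V_def)
      then show "2 * q \<le> card {v\<in>A. fst v \<noteq> fst u}" using xs by (simp add: X_def A_def)
    qed
    also have "\<dots> = card (SIGMA u:A. {v\<in>A. fst v \<noteq> fst u})" using A by (subst card_SigmaI) auto
    also have "(SIGMA u:A. {v\<in>A. fst v \<noteq> fst u}) = F xs \<union> (F xs)\<inverse>"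
      using A by (auto simp: F_def E_def A_def)
    also have "card \<dots> \<le> card (F xs) + card ((F xs)\<inverse>)" by (rule card_Un_le)
    also have "\<dots> = 2 * card (F xs)" by simp
    finally show ?thesis by simp
  qed
  have half: "real n * (1/2) ^ q \<le> 1/2"
  proof -
    have "2 * real n \<le> 2 ^ q" using q
      by (metis n_def of_nat_le_iff of_nat_mult of_nat_numeral of_nat_power)
    thus ?thesis by (simp add: field_simps power_divide)
  qed
  have "(\<Sum>\<omega>\<in>Pow E. \<Sum>xs\<in>X. if \<omega> \<inter> F xs = G xs then 1 else 0 :: real)
      = (\<Sum>xs\<in>X. real (card {\<omega> \<in> Pow E. \<omega> \<inter> F xs = G xs}))"
    using finE by (subst sum.swap) (simp add: sum.If_cases Int_def)
  also have "\<dots> = (\<Sum>xs\<in>X. 2 ^ card E * (1/2) ^ card (F xs))"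
    using finE by (intro sum.cong card_subsets_with_trace) (auto simp: F_def G_def)
  also have "\<dots> \<le> (\<Sum>xs\<in>X. 2 ^ card E * (1/2) ^ (length xs * q))"
    by (intro sum_mono mult_left_mono power_decreasing cardF) auto
  also have "\<dots> \<le> (\<Sum>xs\<in>(\<Union>l\<in>{1..n}. {xs. set xs \<subseteq> V \<and> length xs = l}). 2 ^ card E * (1/2) ^ (length xs * q))"
    by (intro sum_mono2 X_sub) (use V in \<open>auto intro: finite_lists_length_eq\<close>)
  also have "\<dots> = (\<Sum>l\<in>{1..n}. \<Sum>xs\<in>{xs. set xs \<subseteq> V \<and> length xs = l}. 2 ^ card E * (1/2) ^ (length xs * q))"
    using V by (intro sum.UNION_disjoint) (auto intro: finite_lists_length_eq)
  also have "\<dots> = (\<Sum>l\<in>{1..n}. 2 ^ card E * (real n * (1/2) ^ q) ^ l)"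
  proof (rule sum.cong)
    fix l
    have "(\<Sum>xs\<in>{xs. set xs \<subseteq> V \<and> length xs = l}. 2 ^ card E * (1/2) ^ (length xs * q) :: real)
        = (\<Sum>xs\<in>{xs. set xs \<subseteq> V \<and> length xs = l}. 2 ^ card E * (1/2) ^ (l * q))"
      by (intro sum.cong) auto
    also have "\<dots> = real n ^ l * (2 ^ card E * (1/2) ^ (l * q))"
      using V by (simp add: card_lists_length_eq)
    also have "\<dots> = 2 ^ card E * (real n * (1/2) ^ q) ^ l"
      by (simp add: power_mult_distrib power_mult[symmetric] mult_ac)
    finally show "(\<Sum>xs\<in>{xs. set xs \<subseteq> V \<and> length xs = l}. 2 ^ card E * (1/2) ^ (length xs * q) :: real)
        = 2 ^ card E * (real n * (1/2) ^ q) ^ l" .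
  qed simp
  also have "\<dots> \<le> (\<Sum>l\<in>{1..n}. 2 ^ card E * (1/2) ^ l)"
    using half by (intro sum_mono mult_left_mono power_mono) auto
  also have "\<dots> = 2 ^ card E * (\<Sum>l\<in>{1..n}. (1/2) ^ l)" by (simp add: sum_distrib_left)
  also have "(\<Sum>l\<in>{1..n}. (1/2 :: real) ^ l) = 1 - (1/2) ^ n" by (induction n) auto
  also have "2 ^ card E * (1 - (1/2 :: real) ^ n) < real (card (Pow E))"
    using finE by (simp add: card_Pow)
  finally obtain \<omega> where \<omega>: "\<omega> \<subseteq> E" "(\<Sum>xs\<in>X. if \<omega> \<inter> F xs = G xs then 1 else 0 :: real) < 1"
    using exists_weight_less_one[of "\<lambda>\<omega>. \<Sum>xs\<in>X. if \<omega> \<inter> F xs = G xs then 1 else 0" "Pow E"] by auto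
  have avoid: "\<omega> \<inter> F xs \<noteq> G xs" if "xs \<in> X" for xs
  proof
    assume eq: "\<omega> \<inter> F xs = G xs"
    have "(if \<omega> \<inter> F xs = G xs then 1 else 0 :: real)
        \<le> (\<Sum>xs\<in>X. if \<omega> \<inter> F xs = G xs then 1 else 0)"
      by (rule member_le_sum[OF that]) (use finX in auto)
    with \<omega>(2) eq show False by simp
  qed
  define D where "D = \<lparr> pverts = V, parcs = \<omega> \<union> (E - \<omega>)\<inverse> \<rparr>"
  have asym: "(v, u) \<notin> E" if "(u, v) \<in> E" for u v using that by (auto simp: E_def)
  have "orientation_of D (complete_multipartite m r)"
    unfolding orientation_of_def
  proof (intro conjI)
    show "pverts D = pverts (complete_multipartite m r)"
      by (simp add: D_def complete_multipartite_def V_def)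
    show "parcs D \<subseteq> parcs (complete_multipartite m r)"
      using \<omega>(1) by (auto simp: D_def complete_multipartite_def V_def E_def)
    show "\<forall>(u, v)\<in>parcs (complete_multipartite m r). ((u, v) \<in> parcs D) = ((v, u) \<notin> parcs D)"
    proof clarify
      fix a b c d
      assume "((a, b), (c, d)) \<in> parcs (complete_multipartite m r)"
      then have "((a, b), (c, d)) \<in> E \<or> ((c, d), (a, b)) \<in> E"
        by (auto simp: complete_multipartite_def E_def V_def)
      thus "(((a, b), (c, d)) \<in> parcs D) = (((c, d), (a, b)) \<notin> parcs D)"
        using \<omega>(1) asym by (auto simp: D_def)
    qed
  qed
  moreover have "\<exists>i<r. card {v\<in>A. fst v \<noteq> i} < 2 * q"
    if A: "A \<subseteq> V" "acyclic (parcs D \<inter> A \<times> A)" for A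
  proof (rule ccontr)
    assume neg: "\<not> ?thesis"
    have finA: "finite A" using A V by (auto intro: finite_subset)
    obtain xs where xs: "distinct xs" "set xs = A" "sorted_wrt (\<lambda>x y. (y, x) \<notin> parcs D) xs"
      using exists_topological_list[OF finA A(2)] by blast
    \<comment> \<open>For q = 0 even the empty set would violate the bound, and its ordering is not
      in \<open>X\<close>.\<close>
    have "q \<noteq> 0"
    proof
      assume "q = 0"
      hence "2 * (r * m) \<le> 1" using q by simp
      moreover have "r * m \<ge> 1" using r m by simp
      ultimately show False by linarith
    qed
    hence "A \<noteq> {}" using neg r by auto
    moreover have "\<forall>i<r. 2 * q \<le> card {v\<in>A. fst v \<noteq> i}" using neg by (meson not_less)
    ultimately have "xs \<in> X" using xs A(1) unfolding X_def by blast
    have backward: "(xs ! j, xs ! i) \<notin> parcs D" if "i < j" "j < length xs" for i j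
      using xs(3) that by (simp add: sorted_wrt_iff_nth_less)
    \<comment> \<open>As no arc runs backwards along \<open>xs\<close>, an edge points to the larger
      part index exactly if its end in the smaller part comes first.\<close>
    have "\<omega> \<inter> F xs = G xs"
    proof (intro subset_antisym subsetI)
      fix e assume e: "e \<in> \<omega> \<inter> F xs"
      obtain u v where uv: "e = (u, v)" by (cases e)
      obtain i j where ij: "i < length xs" "j < length xs" "xs ! i = u" "xs ! j = v"
        using e uv by (auto simp: F_def in_set_conv_nth)
      have "u \<noteq> v" using e uv by (auto simp: F_def E_def)
      hence "i \<noteq> j" using ij by auto
      moreover have "\<not> j < i" using backward[of j i] ij e uv by (auto simp: D_def)
      ultimately have "i < j" by simp
      thus "e \<in> G xs" using ij e uv by (auto simp: G_def)
    next
      fix e assume e: "e \<in> G xs"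
      then obtain u v i j where uv: "e = (u, v)" "(u, v) \<in> F xs" "i < j" "j < length xs" "xs ! i = u" "xs ! j = v"
        by (auto simp: G_def)
      have "(v, u) \<notin> parcs D" using backward[of i j] uv by simp
      hence "(u, v) \<in> \<omega>" using uv(2) by (auto simp: D_def F_def)
      thus "e \<in> \<omega> \<inter> F xs" using uv by simp
    qed
    with avoid[OF \<open>xs \<in> X\<close>] show False by simp
  qed
  ultimately show ?thesis unfolding V_def by blast
qed

section \<open>Lists that miss every distribution of colours over parts\<close>

text \<open>Removing one point from a ground set of size M \<ge> 2k keeps the fraction (M - k)/M
  \<ge> 1/2 of its k-subsets. Hence a random k-subset misses a given set of n points with
  probability at least 2^(-n).\<close>

lemma binomial_le_two_power_mult_binomial_diff:
  assumes "2 * k + n \<le> N"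
  shows "N choose k \<le> 2 ^ n * ((N - n) choose k)"
  using assms
proof (induction n)
  case (Suc n)
  define M where "M = N - n"
  have M: "2 * k \<le> M" "M > 0" using Suc.prems by (auto simp: M_def)
  have "M * (M choose k) \<le> 2 * (M - k) * (M choose k)" using M by (intro mult_right_mono) auto
  also have "\<dots> = M * (2 * ((M - 1) choose k))" using binomial_absorb_comp[of M k] by simp
  finally have "M choose k \<le> 2 * ((M - 1) choose k)" using M by simp
  hence "2 ^ n * (M choose k) \<le> 2 ^ Suc n * ((N - Suc n) choose k)" by (simp add: M_def)
  moreover have "N choose k \<le> 2 ^ n * (M choose k)" using Suc by (simp add: M_def)
  ultimately show ?case by (rule order_trans[rotated])
qed simp

text \<open>Markov's inequality: the mean fibre size is 8k/r, so at most two thirds of the fibres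
  exceed 12k/r.\<close>

lemma card_small_fibres:
  fixes k r :: nat
  assumes "\<And>c. c \<in> {1..8 * k} \<Longrightarrow> \<phi> c < r"
  shows "r \<le> 3 * card {i. i < r \<and> card {c\<in>{1..8 * k}. \<phi> c = i} * r \<le> 12 * k}"
proof -
  define \<nu> where "\<nu> i = card {c\<in>{1..8 * k}. \<phi> c = i}" for i
  define B where "B = {i. i < r \<and> \<not> \<nu> i * r \<le> 12 * k}"
  define S where "S = {i. i < r \<and> \<nu> i * r \<le> 12 * k}"
  have fin: "finite B" "finite S" by (auto simp: B_def S_def)
  have "{..<r} = S \<union> B" "S \<inter> B = {}" by (auto simp: S_def B_def)
  hence "r = card S + card B" using fin by (metis card_Un_disjoint card_lessThan)
  moreover have "3 * card B \<le> 2 * r"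
  proof (cases "k = 0")
    case True
    then show ?thesis by (simp add: B_def \<nu>_def)
  next
    case False
    have "(\<Sum>i<r. \<nu> i) = card (\<Union>i<r. {c\<in>{1..8 * k}. \<phi> c = i})"
      unfolding \<nu>_def by (subst card_UN_disjoint) auto
    also have "(\<Union>i<r. {c\<in>{1..8 * k}. \<phi> c = i}) = {1..8 * k}" using assms by auto
    finally have total: "(\<Sum>i<r. \<nu> i) = 8 * k" by simp
    have "card B * (12 * k) = (\<Sum>i\<in>B. 12 * k)" by simp
    also have "\<dots> \<le> (\<Sum>i\<in>B. \<nu> i * r)" by (intro sum_mono) (auto simp: B_def)
    also have "\<dots> \<le> (\<Sum>i<r. \<nu> i * r)" by (intro sum_mono2) (auto simp: B_def)
    also have "\<dots> = 8 * k * r" using total by (simp add: sum_distrib_right[symmetric])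
    finally have "(3 * card B) * (4 * k) \<le> (2 * r) * (4 * k)" by simp
    thus ?thesis using False by simp
  qed
  ultimately show ?thesis unfolding S_def \<nu>_def by linarith
qed

text \<open>The lists are independent random k-subsets of 8k colours. For fixed
  \<open>\<phi>\<close>, at least r/3 parts own at most 12k/r colours, and each of their vertices is
  missed with probability at least 2^(-12k/r). So 2^(-X), X the number of missed vertices, has mean
  at most exp(-m r 2^(-12k/r) / 6). The left side of \<open>large\<close> is the logarithm of
  r^(8k), the number of maps \<open>\<phi>\<close>, times 2^M.\<close>

lemma exists_missing_lists:
  fixes r m k M :: nat
  assumes r: "r \<ge> 2"
    and large: "8 * real k * ln (real r) + real M * ln 2 < real m * real r * 2 powr (- 12 * real k / real r) / 6"
  shows "\<exists>L. (\<forall>v\<in>{..<r} \<times> {..<m}. L v \<subseteq> {1..8 * k} \<and> card (L v) = k) \<and>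
    (\<forall>\<phi>. (\<forall>c\<in>{1..8 * k}. \<phi> c < r) \<longrightarrow>
      M < card {v\<in>{..<r} \<times> {..<m}. \<forall>c\<in>L v. \<phi> c \<noteq> fst v})"
proof -
  define V where "V = {..<r} \<times> {..<m}"
  define N where "N = 8 * k"
  define W where "W = 2 powr (- 12 * real k / real r)"
  define K where "K = {A. A \<subseteq> {1..N} \<and> card A = k}"
  define \<Omega> where "\<Omega> = PiE V (\<lambda>_. K)"
  define \<Phi> where "\<Phi> = PiE {1..N} (\<lambda>_. {..<r})"
  define miss where "miss \<phi> L = (\<Prod>v\<in>V. if \<forall>c\<in>L v. \<phi> c \<noteq> fst v then 1/2 else 1 :: real)"
    for \<phi> and L :: "nat \<times> nat \<Rightarrow> nat set"
  have finV: "finite V" by (simp add: V_def)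
  have finK: "finite K" by (simp add: K_def)
  have cardK: "card K = N choose k" using n_subsets[of "{1..N}" k] by (simp add: K_def)
  have cardK_pos: "real (card K) > 0" by (simp add: cardK N_def)
  have card\<Omega>: "real (card \<Omega>) = real (card K) ^ card V" by (simp add: \<Omega>_def card_PiE finV)
  have card\<Phi>: "real (card \<Phi>) = real r ^ N" by (simp add: \<Phi>_def card_PiE)
  have W: "W > 0" "W \<le> 1" by (auto simp: W_def powr_le_one_le powr_minus divide_simps intro: ge_one_powr_ge_zero)
  have moment: "(\<Sum>L\<in>\<Omega>. miss \<phi> L) \<le> real (card \<Omega>) * exp (- (real m * real r * W / 6))"
    if \<phi>: "\<phi> \<in> \<Phi>" for \<phi>
  proof -
    define \<nu> where "\<nu> i = card {c\<in>{1..N}. \<phi> c = i}" for i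
    \<comment> \<open>A lower bound for the probability that a list in part i is missed; parts
      owning many colours are given up.\<close>
    define w where "w i = (if \<nu> i * r \<le> 12 * k then W else 0)" for i
    have factor: "(\<Sum>A\<in>K. if \<forall>c\<in>A. \<phi> c \<noteq> i then 1/2 else 1) \<le> real (card K) * exp (- w i / 2)" for i
    proof -
      have "card {A\<in>K. \<forall>c\<in>A. \<phi> c \<noteq> i} = card {A. A \<subseteq> {1..N} - {c\<in>{1..N}. \<phi> c = i} \<and> card A = k}"
        by (rule arg_cong[of _ _ card]) (auto simp: K_def)
      also have "\<dots> = (N - \<nu> i) choose k"
        by (subst n_subsets, simp, subst card_Diff_subset) (auto simp: \<nu>_def)
      finally have disj: "card {A\<in>K. \<forall>c\<in>A. \<phi> c \<noteq> i} = (N - \<nu> i) choose k" .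
      have "real (card K) * w i \<le> real ((N - \<nu> i) choose k)"
      proof (cases "\<nu> i * r \<le> 12 * k")
        case True
        \<comment> \<open>By r \<ge> 2 a small fibre has at most 6k colours, so a palette of 8k = 2k
          + 6k colours meets the hypothesis of the binomial estimate.\<close>
        have "\<nu> i * 2 \<le> 12 * k" using True r by (meson le_trans mult_le_mono2)
        hence "card K \<le> 2 ^ \<nu> i * ((N - \<nu> i) choose k)"
          unfolding cardK by (intro binomial_le_two_power_mult_binomial_diff) (simp add: N_def)
        hence le: "real (card K) \<le> 2 ^ \<nu> i * real ((N - \<nu> i) choose k)"
          by (metis of_nat_le_iff of_nat_mult of_nat_numeral of_nat_power)
        have "real (\<nu> i) * real r \<le> 12 * real k" using True
          by (metis of_nat_le_iff of_nat_mult of_nat_numeral)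
        hence "real (\<nu> i) \<le> 12 * real k / real r" using r by (simp add: field_simps)
        hence "2 ^ \<nu> i * W \<le> 2 powr (12 * real k / real r) * W"
          using W by (simp add: powr_realpow[symmetric])
        also have "\<dots> = 1" by (simp add: W_def powr_add[symmetric])
        finally have "2 ^ \<nu> i * W \<le> 1" .
        have "real (card K) * W \<le> 2 ^ \<nu> i * real ((N - \<nu> i) choose k) * W"
          using le W by (intro mult_right_mono) auto
        also have "\<dots> = (2 ^ \<nu> i * W) * real ((N - \<nu> i) choose k)" by simp
        also have "\<dots> \<le> 1 * real ((N - \<nu> i) choose k)"
          using \<open>2 ^ \<nu> i * W \<le> 1\<close> by (intro mult_right_mono) auto
        finally show ?thesis using True by (simp add: w_def)
      qed (simp add: w_def)
      moreover have "(\<Sum>A\<in>K. if \<forall>c\<in>A. \<phi> c \<noteq> i then 1/2 else 1 :: real)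
          = (\<Sum>A\<in>K. 1 - (if \<forall>c\<in>A. \<phi> c \<noteq> i then 1/2 else 0))"
        by (intro sum.cong) auto
      moreover have "\<dots> = real (card K) - real (card {A\<in>K. \<forall>c\<in>A. \<phi> c \<noteq> i}) / 2"
        using finK by (simp add: sum_subtractf sum.If_cases Collect_conj_eq)
      ultimately have "(\<Sum>A\<in>K. if \<forall>c\<in>A. \<phi> c \<noteq> i then 1/2 else 1 :: real) \<le> real (card K) * (1 - w i / 2)"
        using disj by (simp add: algebra_simps)
      also have "\<dots> \<le> real (card K) * exp (- w i / 2)"
        using exp_ge_add_one_self[of "- w i / 2"] by (intro mult_left_mono) auto
      finally show ?thesis .
    qed
    have "real r * W / 3 \<le> (\<Sum>i<r. w i)"
    proof -
      have "r \<le> 3 * card {i. i < r \<and> \<nu> i * r \<le> 12 * k}"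
        unfolding \<nu>_def N_def using \<phi> by (intro card_small_fibres) (auto simp: \<Phi>_def N_def)
      hence "real r \<le> 3 * real (card {i. i < r \<and> \<nu> i * r \<le> 12 * k})" by linarith
      hence "real r * W / 3 \<le> real (card {i. i < r \<and> \<nu> i * r \<le> 12 * k}) * W"
        using W by (simp add: field_simps)
      also have "\<dots> = (\<Sum>i<r. w i)"
        by (simp add: w_def sum.If_cases Collect_conj_eq lessThan_def)
      finally show ?thesis .
    qed
    hence "real m * (real r * W / 3) \<le> real m * (\<Sum>i<r. w i)" by (intro mult_left_mono) auto
    also have "\<dots> = (\<Sum>v\<in>V. w (fst v))"
    proof -
      have "(\<Sum>v\<in>V. w (fst v)) = (\<Sum>i<r. \<Sum>j<m. w i)"
        unfolding V_def by (subst sum.cartesian_product) (simp add: case_prod_beta)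
      thus ?thesis by (simp add: sum_distrib_left)
    qed
    finally have "real m * real r * W / 6 \<le> (\<Sum>v\<in>V. w (fst v)) / 2"
      by (simp add: mult_ac)
    hence wsum: "real m * real r * W / 6 \<le> (\<Sum>v\<in>V. w (fst v) / 2)"
      unfolding sum_divide_distrib .
    have "(\<Sum>L\<in>\<Omega>. miss \<phi> L) = (\<Prod>v\<in>V. \<Sum>A\<in>K. if \<forall>c\<in>A. \<phi> c \<noteq> fst v then 1/2 else 1)"
      unfolding miss_def \<Omega>_def by (subst prod_sum_PiE) (auto simp: finV finK)
    also have "\<dots> \<le> (\<Prod>v\<in>V. real (card K) * exp (- w (fst v) / 2))"
      by (intro prod_mono conjI factor sum_nonneg) auto
    also have "\<dots> = real (card \<Omega>) * exp (- (\<Sum>v\<in>V. w (fst v) / 2))"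
      using finV by (simp add: prod.distrib card\<Omega> exp_sum[symmetric] sum_negf)
    also have "\<dots> \<le> real (card \<Omega>) * exp (- (real m * real r * W / 6))"
      using wsum by (intro mult_left_mono) auto
    finally show ?thesis .
  qed
  have "(\<Sum>L\<in>\<Omega>. \<Sum>\<phi>\<in>\<Phi>. 2 ^ M * miss \<phi> L) = (\<Sum>\<phi>\<in>\<Phi>. 2 ^ M * (\<Sum>L\<in>\<Omega>. miss \<phi> L))"
    by (subst sum.swap) (simp add: sum_distrib_left)
  also have "\<dots> \<le> (\<Sum>\<phi>\<in>\<Phi>. 2 ^ M * (real (card \<Omega>) * exp (- (real m * real r * W / 6))))"
    by (intro sum_mono mult_left_mono moment) auto
  also have "\<dots> = real (card \<Omega>) * (real r ^ N * 2 ^ M * exp (- (real m * real r * W / 6)))"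
    by (simp add: card\<Phi>)
  also have "real r ^ N * 2 ^ M = exp (8 * real k * ln (real r) + real M * ln 2)"
  proof -
    have "real r ^ N = exp (real N * ln (real r))" "(2::real) ^ M = exp (real M * ln 2)"
      using r by (simp_all add: exp_of_nat_mult)
    thus ?thesis by (simp add: exp_add N_def)
  qed
  also have "exp (8 * real k * ln (real r) + real M * ln 2) * exp (- (real m * real r * W / 6)) < 1"
    using large by (simp add: W_def flip: exp_add)
  hence "real (card \<Omega>) * (exp (8 * real k * ln (real r) + real M * ln 2) * exp (- (real m * real r * W / 6)))
      < real (card \<Omega>)"
    using cardK_pos by (simp add: card\<Omega>)
  finally obtain L where L: "L \<in> \<Omega>" "(\<Sum>\<phi>\<in>\<Phi>. 2 ^ M * miss \<phi> L) < 1"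
    using exists_weight_less_one[of "\<lambda>L. \<Sum>\<phi>\<in>\<Phi>. 2 ^ M * miss \<phi> L" \<Omega>] by auto
  have miss_pos: "miss \<phi> L \<ge> 0" for \<phi> unfolding miss_def by (intro prod_nonneg) auto
  have "M < card {v\<in>V. \<forall>c\<in>L v. \<phi> c \<noteq> fst v}" if \<phi>: "\<forall>c\<in>{1..N}. \<phi> c < r" for \<phi>
  proof (rule ccontr)
    assume le: "\<not> ?thesis"
    \<comment> \<open>The union bound covers only the extensional maps in \<open>\<Phi>\<close>;
      restriction changes nothing on the lists.\<close>
    define \<phi>' where "\<phi>' = restrict \<phi> {1..N}"
    have mem: "\<phi>' \<in> \<Phi>" using \<phi> by (auto simp: \<phi>'_def \<Phi>_def)
    have "L v \<subseteq> {1..N}" if "v \<in> V" for v using L(1) that by (auto simp: \<Omega>_def K_def)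
    hence "{v\<in>V. \<forall>c\<in>L v. \<phi>' c \<noteq> fst v} = {v\<in>V. \<forall>c\<in>L v. \<phi> c \<noteq> fst v}"
      unfolding \<phi>'_def by (intro Collect_cong conj_cong ball_cong refl) (auto simp: subset_iff)
    hence "1 \<le> 2 ^ M * miss \<phi>' L"
      unfolding miss_def prod_half_if[OF finV]
      using le by (intro one_le_two_power_mult_half_power) simp
    also have "\<dots> \<le> (\<Sum>\<phi>\<in>\<Phi>. 2 ^ M * miss \<phi> L)"
      by (rule member_le_sum[OF mem]) (use miss_pos in \<open>auto simp: \<Phi>_def intro: finite_PiE\<close>)
    finally show False using L(2) by simp
  qed
  moreover have "L v \<subseteq> {1..N} \<and> card (L v) = k" if "v \<in> V" for v
    using L(1) that by (auto simp: \<Omega>_def K_def)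
  ultimately show ?thesis unfolding V_def N_def by blast
qed

section \<open>List colourability of digraphs\<close>

text \<open>The predicate under \<open>LEAST\<close> in \<open>list_dichromatic_number\<close>,
  named so that its monotonicity in \<open>k\<close> can be used.\<close>

definition list_colourable :: "nat \<Rightarrow> 'a pair_pre_digraph \<Rightarrow> bool" where
  "list_colourable k D \<longleftrightarrow>
     (\<forall>L. list_assignment k D L \<longrightarrow> (\<exists>f. accepted D L f \<and> proper_colouring D f))"

lemma list_colourable_mono:
  assumes "list_colourable k D" "k \<le> l"
  shows "list_colourable l D"
  unfolding list_colourable_def
proof (intro allI impI)
  fix L assume L: "list_assignment l D L"
  have "\<exists>B. B \<subseteq> L v \<and> card B = k" if "v \<in> pverts D" for v
  proof -
    have "k \<le> card (L v)" using L that assms(2) by (simp add: list_assignment_def)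
    thus ?thesis by (meson obtain_subset_with_card_n)
  qed
  hence "\<forall>v\<in>pverts D. \<exists>B. B \<subseteq> L v \<and> card B = k" by blast
  from bchoice[OF this] obtain L' where
    L': "\<And>v. v \<in> pverts D \<Longrightarrow> L' v \<subseteq> L v \<and> card (L' v) = k" by meson
  have "list_assignment k D L'"
    unfolding list_assignment_def
  proof
    fix v assume v: "v \<in> pverts D"
    then have "L v \<subseteq> {1..}" "finite (L v)" using L by (auto simp: list_assignment_def)
    with L'[OF v] show "L' v \<subseteq> {1..} \<and> finite (L' v) \<and> card (L' v) = k"
      by (meson finite_subset order_trans)
  qed
  then obtain f where "accepted D L' f" "proper_colouring D f"
    using assms(1) by (auto simp: list_colourable_def)
  moreover from this have "accepted D L f" using L' by (auto simp: accepted_def)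
  ultimately show "\<exists>f. accepted D L f \<and> proper_colouring D f" by blast
qed

lemma list_dichromatic_number_le:
  assumes "list_colourable k D"
  shows "list_dichromatic_number D \<le> k"
  using assms unfolding list_dichromatic_number_def list_colourable_def by (intro Least_le)

text \<open>The size \<open>l\<close> guarantees that the \<open>LEAST\<close> is attained; by
  monotonicity, failure at \<open>k\<close> excludes every size up to \<open>k\<close>.\<close>

lemma list_dichromatic_number_greater:
  assumes "list_colourable l D" "\<not> list_colourable k D"
  shows "k < list_dichromatic_number D"
proof (rule ccontr)
  assume "\<not> ?thesis"
  hence "list_dichromatic_number D \<le> k" by simp
  moreover have "list_colourable (list_dichromatic_number D) D"
    using assms(1) unfolding list_dichromatic_number_def list_colourable_def by (rule LeastI)
  ultimately show False using assms(2) list_colourable_mono by blast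
qed

text \<open>Serves the lower bound for bounded \<open>m\<close>, where only the trivial estimate by
  1 is required.\<close>

lemma not_list_colourable_0:
  assumes "pverts D \<noteq> {}"
  shows "\<not> list_colourable 0 D"
proof
  assume "list_colourable 0 D"
  moreover have "list_assignment 0 D (\<lambda>_. {})" by (simp add: list_assignment_def)
  ultimately obtain f where "accepted D (\<lambda>_. {}) f" by (auto simp: list_colourable_def)
  with assms show False by (auto simp: accepted_def)
qed

text \<open>A cycle of the arc relation is a closed walk, and every closed walk yields a cycle in
  the sense of the library.\<close>

lemma acyclic_if_acyclic_digraph:
  assumes "acyclic_digraph (with_proj D \<restriction> A)"
  shows "acyclic (parcs D \<inter> A \<times> A)"
proof -
  interpret wf_digraph "with_proj D \<restriction> A" by unfold_locales auto
  have ends: "arcs_ends (with_proj D \<restriction> A) = parcs D \<inter> A \<times> A"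
    by (auto simp: arcs_ends_conv image_iff)
  have "(u, u) \<notin> (arcs_ends (with_proj D \<restriction> A))\<^sup>+" for u
  proof
    assume "(u, u) \<in> (arcs_ends (with_proj D \<restriction> A))\<^sup>+"
    then obtain p where "awalk u p u" "p \<noteq> []" using reachable1_awalk[of u u] by blast
    hence "closed_w p" by (auto simp: closed_w_def)
    hence "\<exists>p. cycle p" by (rule closed_w_imp_cycle)
    with assms show False by (simp add: acyclic_digraph_def)
  qed
  thus ?thesis unfolding acyclic_def ends by blast
qed

lemma acyclic_digraph_if_no_arcs:
  assumes "arcs G = {}"
  shows "acyclic_digraph G"
  using assms unfolding acyclic_digraph_def pre_digraph.cycle_def pre_digraph.awalk_def by auto

section \<open>Bounds for complete multipartite graphs\<close>

lemma pverts_complete_multipartite [simp]: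
  "pverts (complete_multipartite m r) = {..<r} \<times> {..<m}"
  by (simp add: complete_multipartite_def)

lemma pverts_orientation:
  "orientation_of D (complete_multipartite m r) \<Longrightarrow> pverts D = {..<r} \<times> {..<m}"
  by (simp add: orientation_of_def)

text \<open>Makes the \<open>Max\<close> over orientations meaningful: an orientation is determined
  by its arc set.\<close>

lemma finite_orientations:
  assumes "finite (parcs G)"
  shows "finite {D. orientation_of D G}"
proof (rule finite_subset)
  show "{D. orientation_of D G} \<subseteq> (\<lambda>B. \<lparr>pverts = pverts G, parcs = B\<rparr>) ` Pow (parcs G)"
  proof
    fix D assume "D \<in> {D. orientation_of D G}"
    then have "D = \<lparr>pverts = pverts G, parcs = parcs D\<rparr>" "parcs D \<in> Pow (parcs G)"
      by (auto simp: orientation_of_def)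
    thus "D \<in> (\<lambda>B. \<lparr>pverts = pverts G, parcs = B\<rparr>) ` Pow (parcs G)" by blast
  qed
qed (use assms in simp)

lemma finite_parcs_complete_multipartite: "finite (parcs (complete_multipartite m r))"
proof (rule finite_subset)
  show "parcs (complete_multipartite m r) \<subseteq> ({..<r} \<times> {..<m}) \<times> ({..<r} \<times> {..<m})"
    by (auto simp: complete_multipartite_def)
qed simp

text \<open>A colour class inside a single part spans no arcs, whatever the orientation.\<close>

lemma list_colourable_orientation:
  assumes r: "r \<ge> 2" and m: "m \<ge> 2" "ln (real r) \<le> real m"
    and k: "real k > 52 * real r * ln (real m)"
    and D: "orientation_of D (complete_multipartite m r)"
  shows "list_colourable k D"
  unfolding list_colourable_def
proof (intro allI impI)
  fix L assume "list_assignment k D L"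
  then have "\<And>v. v \<in> {..<r} \<times> {..<m} \<Longrightarrow> finite (L v) \<and> card (L v) = k"
    unfolding list_assignment_def pverts_orientation[OF D] by blast
  from exists_part_separating_colouring[OF r m this k]
  obtain f where f_all: "\<forall>u\<in>{..<r} \<times> {..<m}. f u \<in> L u \<and>
      (\<forall>v\<in>{..<r} \<times> {..<m}. f u = f v \<longrightarrow> fst u = fst v)" ..
  have f: "\<And>u. u \<in> pverts D \<Longrightarrow> f u \<in> L u"
      "\<And>u v. u \<in> pverts D \<Longrightarrow> v \<in> pverts D \<Longrightarrow> f u = f v \<Longrightarrow> fst u = fst v"
    using f_all unfolding pverts_orientation[OF D] by blast+
  have "proper_colouring D f"
    unfolding proper_colouring_def
  proof (intro allI acyclic_digraph_if_no_arcs equals0I)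
    fix c e assume "e \<in> arcs (with_proj D \<restriction> {v \<in> pverts D. f v = c})"
    then have "e \<in> parcs D" "fst (fst e) = fst (snd e)" using f(2) by auto
    moreover have "parcs D \<subseteq> parcs (complete_multipartite m r)" using D by (simp add: orientation_of_def)
    ultimately show False by (auto simp: complete_multipartite_def)
  qed
  moreover have "accepted D L f" using f(1) by (simp add: accepted_def)
  ultimately show "\<exists>f. accepted D L f \<and> proper_colouring D f" by blast
qed

text \<open>In a proper colouring each of the 8k colours has a part outside which it occurs on fewer
  than 2q vertices. Sending colours to these parts gives a \<open>\<phi>\<close> with at most M = 8k
  * 2q missed vertices, against the choice of the lists.\<close>

lemma exists_orientation_not_list_colourable:
  assumes r: "r \<ge> 2" and m: "m > 0" and q: "2 * (r * m) \<le> 2 ^ q"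
    and large: "8 * real k * (ln (real r) + 2 * real q * ln 2)
      < real m * real r * 2 powr (- 12 * real k / real r) / 6"
  shows "\<exists>D. orientation_of D (complete_multipartite m r) \<and> \<not> list_colourable k D"
proof -
  define V where "V = {..<r} \<times> {..<m}"
  define M where "M = 8 * k * (2 * q)"
  have "r > 0" using r by simp
  from exists_orientation_acyclic_near_part[OF m this q, folded V_def]
  obtain D where D: "orientation_of D (complete_multipartite m r)"
    and near_all: "\<forall>A\<subseteq>V. acyclic (parcs D \<inter> A \<times> A) \<longrightarrow> (\<exists>i<r. card {v\<in>A. fst v \<noteq> i} < 2 * q)"
    by (elim exE conjE)
  note near = near_all[rule_format]
  have "8 * real k * ln (real r) + real M * ln 2 < real m * real r * 2 powr (- 12 * real k / real r) / 6"
    using large by (simp add: M_def algebra_simps)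
  from exists_missing_lists[OF r this, folded V_def] obtain L
    where L_all: "\<forall>v\<in>V. L v \<subseteq> {1..8 * k} \<and> card (L v) = k"
      and miss: "\<forall>\<phi>. (\<forall>c\<in>{1..8 * k}. \<phi> c < r) \<longrightarrow> M < card {v\<in>V. \<forall>c\<in>L v. \<phi> c \<noteq> fst v}"
    by (elim exE conjE)
  note L = bspec[OF L_all]
  have finV: "finite V" by (simp add: V_def)
  have vD: "pverts D = V" using pverts_orientation[OF D] by (simp add: V_def)
  have "\<not> list_colourable k D"
  proof
    assume "list_colourable k D"
    moreover have "list_assignment k D L"
      unfolding list_assignment_def vD
    proof
      fix v assume "v \<in> V"
      from L[OF this] show "L v \<subseteq> {1..} \<and> finite (L v) \<and> card (L v) = k"
        by (auto intro: finite_subset)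
    qed
    ultimately obtain f where "accepted D L f" "proper_colouring D f"
      unfolding list_colourable_def by blast
    hence f: "\<And>v. v \<in> V \<Longrightarrow> f v \<in> L v" "proper_colouring D f"
      by (auto simp: accepted_def vD)
    define A where "A c = {v \<in> V. f v = c}" for c
    have "\<exists>i<r. card {v \<in> A c. fst v \<noteq> i} < 2 * q" for c
    proof (rule near)
      show "A c \<subseteq> V" by (auto simp: A_def)
      show "acyclic (parcs D \<inter> A c \<times> A c)"
        using f(2) unfolding proper_colouring_def A_def vD by (intro acyclic_if_acyclic_digraph) blast
    qed
    then obtain \<phi> where \<phi>: "\<And>c. \<phi> c < r" "\<And>c. card {v \<in> A c. fst v \<noteq> \<phi> c} < 2 * q" by metis
    \<comment> \<open>A missed vertex is an exception for its own colour \<open>f v\<close>, since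
      that colour lies in its list.\<close>
    have "{v\<in>V. \<forall>c\<in>L v. \<phi> c \<noteq> fst v} \<subseteq> (\<Union>c\<in>{1..8 * k}. {v \<in> A c. fst v \<noteq> \<phi> c})"
    proof
      fix v assume v: "v \<in> {v\<in>V. \<forall>c\<in>L v. \<phi> c \<noteq> fst v}"
      then have "f v \<in> L v" "L v \<subseteq> {1..8 * k}" using f(1) L by auto
      with v show "v \<in> (\<Union>c\<in>{1..8 * k}. {v \<in> A c. fst v \<noteq> \<phi> c})" 
        by (intro UN_I[of "f v"]) (auto simp: A_def)
    qed
    hence "card {v\<in>V. \<forall>c\<in>L v. \<phi> c \<noteq> fst v} \<le> card (\<Union>c\<in>{1..8 * k}. {v \<in> A c. fst v \<noteq> \<phi> c})"
      using finV by (intro card_mono) (auto simp: A_def)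
    also have "\<dots> \<le> (\<Sum>c\<in>{1..8 * k}. card {v \<in> A c. fst v \<noteq> \<phi> c})" by (rule card_UN_le) simp
    also have "\<dots> \<le> (\<Sum>c\<in>{1..8 * k}. 2 * q)" by (intro sum_mono less_imp_le \<phi>(2))
    also have "\<dots> = M" by (simp add: M_def)
    finally show False using miss[rule_format, of \<phi>] \<phi>(1) by simp
  qed
  with D show ?thesis by blast
qed

text \<open>With q about log 2 (2 r m) the left side is at most r ln m (ln r + 2 ln m). The bound k
  \<le> r ln m / 24 gives 2^(-12k/r) \<ge> m^(-1/2), so the right side is at least r sqrt m /
  6.\<close>

lemma list_size_below_threshold:
  assumes r: "r \<ge> 2" and m: "m \<ge> 2" and k: "real k \<le> real r * ln (real m) / 24"
    and asymp: "6 * ln (real m) * (ln (real r) + 2 * ln (real m)) < sqrt (real m)"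
  shows "\<exists>q. 2 * (r * m) \<le> 2 ^ q \<and> 8 * real k * (ln (real r) + 2 * real q * ln 2)
      < real m * real r * 2 powr (- 12 * real k / real r) / 6"
proof -
  define q where "q = nat \<lceil>log 2 (2 * real r * real m)\<rceil>"
  have pos: "2 * real r * real m > 0" using r m by simp
  have "2 * real r * real m = 2 powr log 2 (2 * real r * real m)" using pos by simp
  also have "\<dots> \<le> 2 powr real q" unfolding q_def by (intro powr_mono) (auto simp: of_nat_ceiling)
  also have "\<dots> = 2 ^ q" by (simp add: powr_realpow)
  finally have q1: "2 * (r * m) \<le> 2 ^ q"
    by (metis mult.assoc of_nat_le_iff of_nat_mult of_nat_numeral of_nat_power)
  have lnm: "ln (real m) > 0" "ln 2 \<le> ln (real m)" and lnr: "ln (real r) > 0" using r m by auto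
  have "log 2 (2 * real r * real m) \<ge> 0"
  proof -
    have "1 * 1 \<le> (2 * real r) * real m" using r m by (intro mult_mono) auto
    thus ?thesis using pos by (subst zero_le_log_cancel_iff) auto
  qed
  hence "real q \<le> log 2 (2 * real r * real m) + 1" unfolding q_def by linarith
  hence "real q * ln 2 \<le> (log 2 (2 * real r * real m) + 1) * ln 2" by (intro mult_right_mono) auto
  also have "\<dots> = ln (2 * real r * real m) + ln 2" by (simp add: log_def field_simps)
  also have "\<dots> = ln (real r) + ln (real m) + 2 * ln 2" using r m by (simp add: ln_mult)
  finally have q2: "real q * ln 2 \<le> ln (real r) + 3 * ln (real m)" using lnm by linarith
  have "8 * real k * (ln (real r) + 2 * real q * ln 2)
      \<le> 8 * (real r * ln (real m) / 24) * (3 * (ln (real r) + 2 * ln (real m)))"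
    using k q2 lnm lnr by (intro mult_mono) auto
  also have "\<dots> = real r / 6 * (6 * ln (real m) * (ln (real r) + 2 * ln (real m)))" by simp
  also have "\<dots> < real r / 6 * sqrt (real m)"
    using asymp r by (intro mult_strict_left_mono) auto
  also have "\<dots> \<le> real m * real r * 2 powr (- 12 * real k / real r) / 6"
  proof -
    have "sqrt (real m) = real m * real m powr (- 1/2)"
      using m by (simp add: powr_minus powr_half_sqrt field_simps)
    also have "real m powr (- 1/2) \<le> 2 powr (- 12 * real k / real r)"
    proof -
      have "12 * real k / real r \<le> 12 * ln (real m) / 24" using k r by (simp add: field_simps)
      hence "12 * real k / real r * ln 2 \<le> 12 * ln (real m) / 24 * 1"
        using ln_2_less_1 lnm by (intro mult_mono) auto
      also have "\<dots> = ln (real m) / 2" by simp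
      finally show ?thesis using m by (simp add: powr_def)
    qed
    finally have "sqrt (real m) \<le> real m * 2 powr (- 12 * real k / real r)" using m by simp
    thus ?thesis using r by (simp add: field_simps)
  qed
  finally show ?thesis using q1 by blast
qed

theorem theorem11:
  fixes \<rho> :: real
  assumes "\<rho> > 3"
  shows "\<exists>c\<^sub>1 c\<^sub>2 :: real. c\<^sub>1 > 0 \<and> c\<^sub>2 > 0 \<and>
    (\<forall>r m :: nat. r \<ge> 2 \<longrightarrow> real m \<ge> max (ln (real r) powr \<rho>) 2 \<longrightarrow>
      c\<^sub>1 * real r * ln (real m) \<le> real (graph_list_dichromatic_number (complete_multipartite m r)) \<and>
      real (graph_list_dichromatic_number (complete_multipartite m r)) \<le> c\<^sub>2 * real r * ln (real m))"
proof -
  \<comment> \<open>The power 1/3 enters through ln r \<le> m^(1/3), which follows from \<rho> >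
    3.\<close>
  have "\<forall>\<^sub>F x :: real in at_top. 6 * ln x * (x powr (1/3) + 2 * ln x) < sqrt x"
    by real_asymp
  then obtain m\<^sub>0 :: real where m0: "\<And>x. x \<ge> m\<^sub>0 \<Longrightarrow> 6 * ln x * (x powr (1/3) + 2 * ln x) < sqrt x"
    by (auto simp: eventually_at_top_linorder)
  define b where "b = max m\<^sub>0 2"
  \<comment> \<open>The value 1/24 serves m \<ge> b. For m < b also ln r < b, so the second value
    makes c r ln m < 1.\<close>
  define c where "c = min (1/24) (1 / (exp b * b))"
  have b: "b \<ge> 2" "b \<ge> m\<^sub>0" by (auto simp: b_def)
  have c: "c > 0" "c \<le> 1/24" "c \<le> 1 / (exp b * b)" using b by (auto simp: c_def)
  have "c * real r * ln (real m) \<le> real (graph_list_dichromatic_number (complete_multipartite m r)) \<and>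
      real (graph_list_dichromatic_number (complete_multipartite m r)) \<le> 53 * real r * ln (real m)"
    if r: "r \<ge> 2" and rm: "real m \<ge> max (ln (real r) powr \<rho>) 2" for r m
  proof -
    define G where "G = complete_multipartite m r"
    \<comment> \<open>Rounding up costs at most 1 \<le> r ln m, hence the constant 53. Rounding
      \<open>k\<close> down is repaired by the strict inequality between \<open>k\<close> and the
      list dichromatic number.\<close>
    define l where "l = nat \<lfloor>52 * real r * ln (real m)\<rfloor> + 1"
    define k where "k = nat \<lfloor>c * real r * ln (real m)\<rfloor>"
    have m: "m \<ge> 2" using rm by simp
    have lnr: "ln (real r) > 0" using r by simp
    have lnm: "ln (real m) \<ge> 1/2" using m by (intro half_le_ln) simp
    have ln_r_le: "ln (real r) \<le> real m powr (1/3)"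
    proof -
      have "ln (real r) = (ln (real r) powr \<rho>) powr (1/\<rho>)"
        using lnr assms by (simp add: powr_powr)
      also have "\<dots> \<le> real m powr (1/\<rho>)" using rm assms by (intro powr_mono2) auto
      also have "\<dots> \<le> real m powr (1/3)" using m assms by (intro powr_mono) (auto simp: field_simps)
      finally show ?thesis .
    qed
    also have "real m powr (1/3) \<le> real m powr 1" using m by (intro powr_mono) auto
    finally have ln_r_le_m: "ln (real r) \<le> real m" using m by simp
    have rlnm: "real r * ln (real m) \<ge> 1"
    proof -
      have "2 * (1/2) \<le> real r * ln (real m)" using r lnm by (intro mult_mono) auto
      thus ?thesis by simp
    qed
    have l: "real l > 52 * real r * ln (real m)" "real l \<le> 53 * real r * ln (real m)"
      unfolding l_def using rlnm by linarith+
    have col: "list_colourable l D" if "orientation_of D G" for D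
      using list_colourable_orientation[OF r m ln_r_le_m l(1)] that by (simp add: G_def)
    have set_eq: "{list_dichromatic_number D | D. orientation_of D G}
        = list_dichromatic_number ` {D. orientation_of D G}" by blast
    have fin: "finite {list_dichromatic_number D | D. orientation_of D G}"
      unfolding set_eq unfolding G_def by (intro finite_imageI finite_orientations finite_parcs_complete_multipartite)
    have "\<exists>D. orientation_of D G \<and> \<not> list_colourable k D"
    proof (cases "real m \<ge> b")
      case True
      have "6 * ln (real m) * (ln (real r) + 2 * ln (real m))
          \<le> 6 * ln (real m) * (real m powr (1/3) + 2 * ln (real m))"
        using ln_r_le lnm by (intro mult_left_mono) auto
      also have "\<dots> < sqrt (real m)" using m0 True b by simp
      finally have asymp: "6 * ln (real m) * (ln (real r) + 2 * ln (real m)) < sqrt (real m)" .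
      have "real k \<le> c * (real r * ln (real m))"
        unfolding k_def using c rlnm by (simp add: mult.assoc)
      also have "\<dots> \<le> 1/24 * (real r * ln (real m))" using c rlnm by (intro mult_right_mono) auto
      finally have "real k \<le> real r * ln (real m) / 24" by simp
      from list_size_below_threshold[OF r m this asymp] obtain q
        where "2 * (r * m) \<le> 2 ^ q" "8 * real k * (ln (real r) + 2 * real q * ln 2)
            < real m * real r * 2 powr (- 12 * real k / real r) / 6" by blast
      with m show ?thesis
        unfolding G_def by (intro exists_orientation_not_list_colourable[OF r]) auto
    next
      case False
      have "real r = exp (ln (real r))" using r by simp
      also have "\<dots> < exp b" using ln_r_le_m False by simp
      finally have "real r < exp b" .
      moreover have "ln (real m) < b"
      proof -
        have "ln (real m) \<le> real m - 1" using m by (intro ln_le_minus_one) simp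
        thus ?thesis using False by linarith
      qed
      ultimately have "real r * ln (real m) < exp b * b"
        using lnm by (intro mult_strict_mono) auto
      hence "c * (real r * ln (real m)) < c * (exp b * b)" using c by simp
      also have "\<dots> \<le> 1 / (exp b * b) * (exp b * b)" using c b by (intro mult_right_mono) auto
      also have "\<dots> = 1" using b by simp
      finally have "k = 0" unfolding k_def by (simp add: mult.assoc floor_less_iff)
      \<comment> \<open>Any orientation will do here; the witness for \<open>q\<close> works because
        n < 2^n.\<close>
      obtain D where "orientation_of D G"
        using exists_orientation_acyclic_near_part[of m r "2 * (r * m)"] r m
        unfolding G_def by (auto simp: less_imp_le[OF less_exp])
      moreover from this have "pverts D \<noteq> {}"
        using r m pverts_orientation[of D m r] by (auto simp: G_def lessThan_empty_iff)
      ultimately have "orientation_of D G \<and> \<not> list_colourable k D"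
        using not_list_colourable_0[of D] \<open>k = 0\<close> by simp
      thus ?thesis ..
    qed
    then obtain D where D: "orientation_of D G" "\<not> list_colourable k D" by blast
    have "k < list_dichromatic_number D" using list_dichromatic_number_greater[OF col D(2)] D(1) by blast
    also have "\<dots> \<le> graph_list_dichromatic_number G"
      unfolding graph_list_dichromatic_number_def using fin D(1) by (intro Max_ge) auto
    finally have "c * real r * ln (real m) \<le> real (graph_list_dichromatic_number G)"
      unfolding k_def by linarith
    moreover have "graph_list_dichromatic_number G \<le> l"
      unfolding graph_list_dichromatic_number_def
    proof (rule Max.boundedI[OF fin])
      show "{list_dichromatic_number D | D. orientation_of D G} \<noteq> {}" using D(1) by blast
    qed (use col list_dichromatic_number_le in blast)
    ultimately show ?thesis using l(2) unfolding G_def by linarith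
  qed
  thus ?thesis using c(1) by (intro exI[of _ c] exI[of _ 53]) auto
qed

end
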